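(* Every zebra-like coloring has a twin that avoids the unit triangle.
   Context: A coloring is a partition $\chi=(\mathfrak{B},\mathfrak{W})$ of $\mathbb{R}^2$ into black and white points; its boundary is the common boundary of $\mathfrak{B}$ and $\mathfrak{W}$. A coloring $\chi'$ is a twin of $\chi$ if they have the same boundary and assign the same colors to all points not on this boundary. A unit triangle is a set of three points with pairwise distances $1$; a coloring avoids the unit triangle if no unit triangle is contained in $\mathfrak{B}$ or in $\mathfrak{W}$. $\chi$ is zebra-like if its boundary is a disjoint union of continuous curves $\mathcal{L}_i$, $i\in\mathbb{Z}$, such that: (a) there is a unit vector $\vec x$ with $\mathcal{L}_i+\vec x=\mathcal{L}_i$ for all $i$; (b) there is a unit vector $\vec y$ orthogonal to $\vec x$ with $\mathcal{L}_{i+1}=\mathcal{L}_i+\frac12\vec x+\frac{\sqrt3}{2}\vec y$ for all $i$; (c) for every $i$, the interior of the region delimited by $\mathcal{L}_i\cup\mathcal{L}_{i+1}$ is colored with a different color than the interior of the region delimited by $\mathcal{L}_{i-1}\cup\mathcal{L}_i$; (d) for every $i$ and all $A\in\mathcal{L}_i$, $B\in\mathcal{L}_{i+1}$: $\|AB\|>1$ if and only if $\theta_{AB}<\frac{\pi}{3}$, where $\theta_{AB}$ is the acute angle between the segment $AB$ and the vector $\vec x$. (A zebra-like coloring need not be polygonal.) *)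

theory Defs
  imports "HOL-Analysis.Analysis"
begin

type_synonym plane = "real ^ 2"

type_synonym coloring = "plane set \<times> plane set"

abbreviation black :: "coloring \<Rightarrow> plane set" where
  "black c \<equiv> fst c"

abbreviation white :: "coloring \<Rightarrow> plane set" where
  "white c \<equiv> snd c"

definition is_coloring :: "coloring \<Rightarrow> bool" where
  "is_coloring c \<longleftrightarrow> black c \<inter> white c = {} \<and> black c \<union> white c = UNIV"

definition boundary :: "coloring \<Rightarrow> plane set" where
  "boundary c = frontier (black c) \<inter> frontier (white c)"

definition twin :: "coloring \<Rightarrow> coloring \<Rightarrow> bool" where
  "twin c' c \<longleftrightarrow>
     is_coloring c' \<and> boundary c' = boundary c \<and>
     (\<forall>p. p \<notin> boundary c \<longrightarrow>
        (p \<in> black c' \<longleftrightarrow> p \<in> black c) \<and> (p \<in> white c' \<longleftrightarrow> p \<in> white c))"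

definition unit_triangle :: "plane set \<Rightarrow> bool" where
  "unit_triangle T \<longleftrightarrow>
     (\<exists>p q r. T = {p, q, r} \<and> dist p q = 1 \<and> dist q r = 1 \<and> dist p r = 1)"

definition avoids_unit_triangle :: "coloring \<Rightarrow> bool" where
  "avoids_unit_triangle c \<longleftrightarrow>
     \<not> (\<exists>T. unit_triangle T \<and> (T \<subseteq> black c \<or> T \<subseteq> white c))"

definition continuous_curve :: "plane set \<Rightarrow> bool" where
  "continuous_curve C \<longleftrightarrow> (\<exists>\<gamma> :: real \<Rightarrow> plane. continuous_on UNIV \<gamma> \<and> C = range \<gamma>)"

text \<open>The region delimited by \<open>C\<close> is the component of the complement of \<open>C\<close> whose frontier is
  all of \<open>C\<close>. If \<open>C\<close> consists of two disjoint periodic curves, each the graph of a continuous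
  function in suitable orthogonal coordinates, then there is exactly one such component, the open
  strip between the two curves: the components above and below have only one of the curves as
  frontier.\<close>

definition delimited_region :: "plane set \<Rightarrow> plane set" where
  "delimited_region C = \<Union> {R \<in> components (- C). frontier R = C}"

definition differently_colored :: "coloring \<Rightarrow> plane set \<Rightarrow> plane set \<Rightarrow> bool" where
  "differently_colored c R S \<longleftrightarrow>
     (R \<subseteq> black c \<and> S \<subseteq> white c) \<or> (R \<subseteq> white c \<and> S \<subseteq> black c)"

text \<open>The absolute value discards the orientation of the segment, so the angle
  lies in the interval from \<open>0\<close> to \<open>pi / 2\<close>.\<close>

definition acute_angle :: "plane \<Rightarrow> plane \<Rightarrow> plane \<Rightarrow> real" where
  "acute_angle x A B = arccos (\<bar>(B - A) \<bullet> x\<bar> / (norm (B - A) * norm x))"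

definition zebra_like :: "coloring \<Rightarrow> bool" where
  "zebra_like c \<longleftrightarrow>
     (\<exists>(L :: int \<Rightarrow> plane set) x y.
        boundary c = (\<Union>i. L i) \<and>
        (\<forall>i j. i \<noteq> j \<longrightarrow> L i \<inter> L j = {}) \<and>
        (\<forall>i. continuous_curve (L i)) \<and>
        norm x = 1 \<and> norm y = 1 \<and> orthogonal x y \<and>
        (\<forall>i. (\<lambda>p. p + x) ` L i = L i) \<and>
        (\<forall>i. L (i + 1) = (\<lambda>p. p + (1 / 2) *\<^sub>R x + (sqrt 3 / 2) *\<^sub>R y) ` L i) \<and>
        (\<forall>i. differently_colored c
               (interior (delimited_region (L i \<union> L (i + 1))))
               (interior (delimited_region (L (i - 1) \<union> L i)))) \<and>
        (\<forall>i. \<forall>A \<in> L i. \<forall>B \<in> L (i + 1). dist A B > 1 \<longleftrightarrow> acute_angle x A B < pi / 3))"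

end

theory Submission
  imports Defs
begin

text \<open>In coordinates along \<open>x\<close> and \<open>y\<close>, condition (d) together with the invariance under
  \<open>x\<close> forces \<open>L 0\<close> to be the graph of a 1-periodic Lipschitz function \<open>f\<close> of small oscillation.
  Colour the half-open strips (lower curve included, upper curve excluded) alternately. Call a unit
  segment steep if it makes an angle of at least \<open>pi / 3\<close> with \<open>x\<close>. Prolonging a steep unit
  segment inside a half-open strip to both boundary curves would give a steep segment longer than
  1 between consecutive curves, against (d), so there is none; but every unit triangle has a
  steep side. Conversely a unit segment that jumps over a whole strip contains a shorter segment
  between consecutive curves, so it is steep, and strictly so because consecutive curves differ by the
  translations by \<open>(\<plusminus>1/2, sqrt 3 / 2)\<close>. Two strictly steep upward unit vectors enclose an angle
  below \<open>pi / 3\<close>, so a monochromatic unit triangle can have neither all vertices in one strip nor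
  vertices in two different strips.\<close>

section \<open>Condition (d) in coordinates and its consequences for one curve\<close>

text \<open>Condition (d) for a segment with horizontal difference \<open>a\<close> and vertical
  difference \<open>b\<close>: the angle with \<open>x\<close> is below \<open>pi / 3\<close>
  exactly when \<open>b\<^sup>2 < 3 * a\<^sup>2\<close>.\<close>

definition dichotomy :: "real \<Rightarrow> real \<Rightarrow> bool" where
  "dichotomy a b \<longleftrightarrow> (1 < a\<^sup>2 + b\<^sup>2 \<longleftrightarrow> b\<^sup>2 < 3 * a\<^sup>2)"

abbreviation hgt :: real where
  "hgt \<equiv> sqrt 3 / 2"

lemma hgt_sq: "hgt\<^sup>2 = 3 / 4"
  by (simp add: power_divide)

text \<open>Rational bounds turn later comparisons between multiples of \<open>hgt\<close> and 1
  into linear arithmetic.\<close>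

lemma hgt_bounds: "43/50 < hgt" "hgt < 87/100"
proof -
  have "1.72 < sqrt 3" by (rule real_less_rsqrt) (simp add: power2_eq_square)
  then show "43/50 < hgt" by simp
  have "sqrt 3 < 1.74" by (rule real_less_lsqrt) (simp_all add: power2_eq_square)
  then show "hgt < 87/100" by simp
qed

text \<open>Here \<open>(s, t)\<close> joins two points of one curve; adding
  \<open>(1/2, hgt)\<close> and integers moves the endpoint to points of the next curve. Take the
  one with horizontal difference at most 1/2 in size. Were that segment longer than 1, its squared
  height would exceed 3/4, so it would be both long and steep.\<close>

lemma dichotomy_upper:
  assumes "\<And>n::int. dichotomy (s + 1/2 + n) (t + hgt)"
  shows "t \<le> 1 - hgt"
proof -
  define \<sigma> where "\<sigma> = s + 1/2 + of_int (- round (s + 1/2))"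
  have "\<bar>\<sigma>\<bar> \<le> 1/2"
    using of_int_round_abs_le[of "s + 1/2"] unfolding \<sigma>_def by (simp add: abs_minus_commute)
  then have "\<sigma>\<^sup>2 \<le> (1/2)\<^sup>2" by (rule abs_le_square_iff[THEN iffD1, OF order_trans]) simp
  then have *: "\<sigma>\<^sup>2 \<le> 1/4" by (simp add: power2_eq_square)
  have "dichotomy \<sigma> (t + hgt)" using assms unfolding \<sigma>_def .
  then have "(t + hgt)\<^sup>2 \<le> 1\<^sup>2"
    using * zero_le_power2[of \<sigma>] unfolding dichotomy_def by (simp only: one_power2) argo
  then show ?thesis using power2_le_imp_le[of "t + hgt" 1] by simp
qed

text \<open>If \<open>0 < t\<close> and \<open>\<bar>s\<bar> \<le> 1\<close>, the segment with
  differences \<open>\<bar>s\<bar> - 1/2\<close> and \<open>t + hgt\<close> is steep, hence of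
  length at most 1; expanding the squares leaves
  \<open>sqrt 3 * t \<le> \<bar>s\<bar> - s\<^sup>2 - t\<^sup>2\<close>. For
  \<open>\<bar>s\<bar> > 1\<close> the bound \<open>1 - hgt\<close> on \<open>t\<close> is
  enough.\<close>

lemma dichotomy_lipschitz_upper:
  assumes D: "\<And>n::int. dichotomy (s + 1/2 + n) (t + hgt)"
  shows "sqrt 3 * t \<le> \<bar>s\<bar>"
proof (cases "t \<le> 0 \<or> 1 < \<bar>s\<bar>")
  case True
  have "sqrt 3 * t \<le> \<bar>s\<bar>" if "1 < \<bar>s\<bar>"
  proof -
    have "sqrt 3 * t \<le> sqrt 3 * (1 - hgt)"
      using dichotomy_upper[OF D] by (intro mult_left_mono) auto
    also have "\<dots> \<le> 1" using hgt_bounds by (simp add: algebra_simps)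
    finally show ?thesis using that by simp
  qed
  moreover have "sqrt 3 * t \<le> 0" if "t \<le> 0" using that by (simp add: mult_nonneg_nonpos)
  ultimately show ?thesis using True by fastforce
next
  case False
  define \<sigma> where "\<sigma> = \<bar>s\<bar> - 1/2"
  have "\<bar>\<sigma>\<bar> \<le> \<bar>1/2\<bar>" using False unfolding \<sigma>_def by linarith
  then have "\<sigma>\<^sup>2 \<le> (1/2)\<^sup>2" by (rule abs_le_square_iff[THEN iffD1])
  then have 1: "3 * \<sigma>\<^sup>2 \<le> 3/4" by (simp add: power2_eq_square)
  have "hgt\<^sup>2 \<le> (t + hgt)\<^sup>2" using False by (intro power_mono) auto
  then have 2: "3/4 \<le> (t + hgt)\<^sup>2" using hgt_sq by simp
  \<comment> \<open>For nonnegative \<open>s\<close> the shift \<open>n = -1\<close> gives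
    \<open>\<sigma>\<close>; for negative \<open>s\<close> the shift \<open>n = 0\<close> gives
    \<open>- \<sigma>\<close>, and \<open>dichotomy\<close> depends only on squares.\<close>
  have "dichotomy \<sigma> (t + hgt)"
  proof (cases "0 \<le> s")
    case True
    then show ?thesis using D[of "-1"] unfolding \<sigma>_def by simp
  next
    case False
    then show ?thesis using D[of 0] unfolding \<sigma>_def dichotomy_def
      by (simp add: power2_eq_square algebra_simps)
  qed
  then have "\<sigma>\<^sup>2 + (t + hgt)\<^sup>2 \<le> 1" using 1 2 unfolding dichotomy_def by argo
  moreover have "\<sigma>\<^sup>2 = \<bar>s\<bar>\<^sup>2 - \<bar>s\<bar> + 1/4"
    unfolding \<sigma>_def by (simp add: power2_eq_square algebra_simps del: abs_mult_self_eq)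
  moreover have "(t + hgt)\<^sup>2 = t\<^sup>2 + sqrt 3 * t + 3/4"
    using hgt_sq by (simp add: power2_sum algebra_simps)
  ultimately show ?thesis using zero_le_power2[of t] zero_le_power2[of "\<bar>s\<bar>"] by linarith
qed

text \<open>Exchanging the two points negates \<open>(s, t)\<close>, which makes the one-sided
  bounds two-sided.\<close>

lemma dichotomy_step:
  assumes "\<And>n::int. dichotomy (s + 1/2 + n) (t + hgt)"
    and "\<And>n::int. dichotomy (- s + 1/2 + n) (- t + hgt)"
  shows "\<bar>t\<bar> \<le> 1 - hgt" "sqrt 3 * \<bar>t\<bar> \<le> \<bar>s\<bar>"
  using dichotomy_upper[OF assms(1)] dichotomy_upper[OF assms(2)]
    dichotomy_lipschitz_upper[OF assms(1)] dichotomy_lipschitz_upper[OF assms(2)]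
  by (cases "0 \<le> t"; simp)+

lemma less_iff_power2_less:
  fixes a b :: real
  assumes "0 \<le> a" "0 \<le> b"
  shows "a < b \<longleftrightarrow> a\<^sup>2 < b\<^sup>2"
  using assms power_mono_iff[of b a 2] by (simp add: not_le[symmetric] del: not_le)

text \<open>The value type is arbitrary because the lemma serves both real functions and membership
  predicates.\<close>

lemma periodic_int:
  fixes f :: "real \<Rightarrow> 'a"
  assumes "\<And>u. f (u + 1) = f u"
  shows "f (u + of_int n) = f u"
proof (induction n rule: int_induct[where k = 0])
  case (step1 i)
  then show ?case using assms[of "u + of_int i"] by (simp add: add.assoc)
next
  case (step2 i)
  then show ?case using assms[of "u + of_int (i - 1)"] by simp
qed simp

section \<open>The curves as graphs of translates of one periodic function\<close>

text \<open>The graph of \<open>f\<close> will be \<open>L 0\<close>, and that of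
  \<open>f (w - 1/2) + hgt\<close> will be \<open>L 1\<close>; the second assumption is condition
  (d) between them.\<close>

locale profile =
  fixes f :: "real \<Rightarrow> real"
  assumes periodic: "f (u + 1) = f u"
    and profile_dichotomy: "dichotomy (w - u) (f (w - 1/2) + hgt - f u)"
begin

lemma f_step: "\<bar>f w - f u\<bar> \<le> 1 - hgt" "sqrt 3 * \<bar>f w - f u\<bar> \<le> \<bar>w - u\<bar>"
proof -
  have D: "dichotomy (q - p + 1/2 + of_int n) (f q - f p + hgt)" for p q n
    using profile_dichotomy[of "q + 1/2 + of_int n" p] periodic_int[of f q n, OF periodic]
    by (simp add: algebra_simps)
  show "\<bar>f w - f u\<bar> \<le> 1 - hgt" "sqrt 3 * \<bar>f w - f u\<bar> \<le> \<bar>w - u\<bar>"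
    using dichotomy_step[of "w - u" "f w - f u"] D[of w u] D[of u w] by simp_all
qed

lemma f_continuous: "continuous_on UNIV f"
proof -
  have "1-lipschitz_on UNIV f"
  proof (rule lipschitz_onI)
    fix u w
    have "1 * \<bar>f u - f w\<bar> \<le> sqrt 3 * \<bar>f u - f w\<bar>" by (intro mult_right_mono) auto
    then show "dist (f u) (f w) \<le> 1 * dist u w"
      using f_step(2)[of u w] by (simp add: dist_real_def)
  qed simp
  then show ?thesis by (rule lipschitz_on_continuous_on)
qed

text \<open>The height function of \<open>L i\<close>, which arises from \<open>L 0\<close> by
  \<open>i\<close> translations along \<open>(1/2, hgt)\<close>.\<close>

definition F :: "int \<Rightarrow> real \<Rightarrow> real" where
  "F i u = f (u - of_int i / 2) + of_int i * hgt"

lemma continuous_F [continuous_intros]: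
  assumes "continuous_on A g"
  shows "continuous_on A (\<lambda>p. F i (g p))"
  unfolding F_def
  by (intro continuous_intros continuous_on_compose2[OF f_continuous] assms) auto

lemma F_dichotomy: "dichotomy (w - u) (F (i + 1) w - F i u)"
  using profile_dichotomy[of "w - of_int i / 2" "u - of_int i / 2"]
  unfolding F_def by (simp add: algebra_simps add_divide_distrib)

text \<open>Height differences deviate from multiples of \<open>hgt\<close> by at most the
  oscillation \<open>1 - hgt\<close> of \<open>f\<close>. As \<open>u\<close> and \<open>w\<close>
  are independent and \<open>1 - hgt < hgt\<close>, consecutive curves are even separated in
  height.\<close>

lemma F_diff_le: "F i u - F j w \<le> of_int (i - j) * hgt + (1 - hgt)"
proof -
  have "F i u - F j w = f (u - of_int i / 2) - f (w - of_int j / 2) + of_int (i - j) * hgt"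
    unfolding F_def of_int_diff left_diff_distrib by simp
  then show ?thesis using f_step(1)[of "u - of_int i / 2" "w - of_int j / 2"] by linarith
qed

lemma F_diff_ge: "of_int (i - j) * hgt - (1 - hgt) \<le> F i u - F j w"
proof -
  have "of_int (j - i) * hgt = - (of_int (i - j) * hgt)"
    unfolding of_int_diff left_diff_distrib by simp
  then show ?thesis using F_diff_le[of j w i u] by linarith
qed

lemma F_less: "F i u < F (i + 1) w"
  using F_diff_ge[of "i + 1" i w u] hgt_bounds by simp

lemma F_less2: "F (i + 1) u < F (i + 2) w"
  using F_less[of "i + 1" u w] by (simp add: add.assoc)

lemma F_mono: "i \<le> j \<Longrightarrow> F i u \<le> F j u"
proof (induction j rule: int_ge_induct)
  case (step j)
  then show ?case using F_less[of j u u] by simp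
qed simp

text \<open>The translations by 1/2 and -1/2 have the same effect because they differ by the
  period.\<close>

lemma F_shift: "F (i + 1) (u + 1/2) = F i u + hgt" "F (i + 1) (u - 1/2) = F i u + hgt"
proof -
  show "F (i + 1) (u + 1/2) = F i u + hgt"
    unfolding F_def by (simp add: algebra_simps add_divide_distrib)
  show "F (i + 1) (u - 1/2) = F i u + hgt"
    using periodic[of "u - of_int i / 2 - 1"]
    unfolding F_def by (simp add: algebra_simps add_divide_distrib)
qed

lemma level_exists: "\<exists>i. F i u \<le> v \<and> v < F (i + 1) u"
proof -
  \<comment> \<open>An estimate that ignores the oscillation of \<open>f\<close>. The error is less
    than one strip on each side, so \<open>v\<close> lies between the curves \<open>k - 1\<close>
    and \<open>k + 2\<close>, in one of three strips.\<close>
  define k where "k = \<lfloor>(v - f u) / hgt\<rfloor>"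
  have "of_int k \<le> (v - f u) / hgt" "(v - f u) / hgt < of_int k + 1"
    unfolding k_def by linarith+
  then have k: "of_int k * hgt \<le> v - f u" "v - f u < (of_int k + 1) * hgt"
    using hgt_bounds by (simp_all add: field_simps)
  have F0: "F 0 u = f u" unfolding F_def by simp
  have "F (k - 1) u \<le> f u + (of_int k - 1) * hgt + (1 - hgt)"
    using F_diff_le[of "k - 1" u 0 u] unfolding F0 by simp
  then have "F (k - 1) u \<le> v" using k(1) hgt_bounds unfolding left_diff_distrib by linarith
  moreover have "f u + (of_int k + 2) * hgt - (1 - hgt) \<le> F (k + 2) u"
    using F_diff_ge[of "k + 2" 0 u u] unfolding F0 by simp
  then have "v < F (k + 2) u" using k(2) hgt_bounds unfolding distrib_right by linarith
  ultimately show ?thesis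
    by (metis (no_types, opaque_lifting) add.assoc diff_add_cancel not_le_imp_less one_add_one)
qed

definition level :: "real \<Rightarrow> real \<Rightarrow> int" where
  "level u v = (THE i. F i u \<le> v \<and> v < F (i + 1) u)"

lemma level_eqI:
  assumes "F i u \<le> v" "v < F (i + 1) u"
  shows "level u v = i"
  unfolding level_def
proof (rule the_equality)
  fix j assume j: "F j u \<le> v \<and> v < F (j + 1) u"
  show "j = i"
  proof (rule ccontr)
    assume "j \<noteq> i"
    then consider "i + 1 \<le> j" | "j + 1 \<le> i" by linarith
    then show False using F_mono[of "i + 1" j u] F_mono[of "j + 1" i u] j assms by cases auto
  qed
qed (use assms in blast)

lemma level: "F (level u v) u \<le> v \<and> v < F (level u v + 1) u"
  using level_exists[of u v] level_eqI by blast

section \<open>Unit segments and consecutive curves\<close>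

text \<open>The intermediate value theorem along the line through \<open>(u, v)\<close> with
  direction \<open>(a, b)\<close>.\<close>

lemma crossing:
  assumes "\<alpha> \<le> \<beta>" "v + \<alpha> * b \<le> F i (u + \<alpha> * a)" "F i (u + \<beta> * a) \<le> v + \<beta> * b"
  shows "\<exists>\<mu>. \<alpha> \<le> \<mu> \<and> \<mu> \<le> \<beta> \<and> F i (u + \<mu> * a) = v + \<mu> * b"
proof -
  have "\<exists>\<mu>\<ge>\<alpha>. \<mu> \<le> \<beta> \<and> v + \<mu> * b - F i (u + \<mu> * a) = 0"
    using assms by (intro IVT' continuous_intros) auto
  then show ?thesis by auto
qed

text \<open>The crossing points differ by \<open>\<beta> - \<alpha>\<close> times the direction, so
  condition (d) speaks about a piece of the line itself.\<close>

lemma dichotomy_crossings: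
  assumes "F i (u + \<alpha> * a) = v + \<alpha> * b" "F (i + 1) (u + \<beta> * a) = v + \<beta> * b"
  shows "dichotomy ((\<beta> - \<alpha>) * a) ((\<beta> - \<alpha>) * b)"
  using F_dichotomy[of "u + \<beta> * a" "u + \<alpha> * a" i] assms by (simp add: algebra_simps)

text \<open>Prolonging the segment backwards to the lower curve and forwards to the upper one keeps
  its slope and makes it longer than 1.\<close>

lemma same_level_not_steep_up:
  assumes unit: "a\<^sup>2 + b\<^sup>2 = 1" and steep: "3 * a\<^sup>2 \<le> b\<^sup>2" and "0 \<le> b"
    and p: "F i u \<le> v" and q: "v + b < F (i + 1) (u + a)"
  shows False
proof -
  have "hgt\<^sup>2 \<le> b\<^sup>2" using unit steep hgt_sq by linarith
  then have b: "hgt \<le> b" using \<open>0 \<le> b\<close> by (rule power2_le_imp_le)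
  \<comment> \<open>One further unit in either direction suffices: from curve \<open>i\<close> to
    curve \<open>i + 1\<close> the height grows by at most 1, and \<open>hgt \<le> b\<close> gives
    \<open>1 < 2 * b\<close>.\<close>
  have "v + (-1) * b \<le> F i (u + (-1) * a)"
    using q b F_diff_le[of "i + 1" "u + a" i "u - a"] hgt_bounds by simp
  then obtain \<alpha> where \<alpha>: "\<alpha> \<le> 0" "F i (u + \<alpha> * a) = v + \<alpha> * b"
    using crossing[of "-1" 0 v b i u a] p by auto
  have "F (i + 1) (u + 2 * a) \<le> v + 2 * b"
    using p b F_diff_le[of "i + 1" "u + 2 * a" i u] hgt_bounds by simp
  then obtain \<beta> where \<beta>: "1 \<le> \<beta>" "F (i + 1) (u + \<beta> * a) = v + \<beta> * b"
    using crossing[of 1 2 v b "i + 1" u a] q by auto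
  \<comment> \<open>The endpoint is strictly below the upper curve, so the prolongation is strict
    even if the segment starts on the lower curve.\<close>
  have "\<beta> \<noteq> 1" using \<beta>(2) q by auto
  then have "1 < (\<beta> - \<alpha>)\<^sup>2" using \<alpha>(1) \<beta>(1) by (simp add: one_less_power)
  moreover have "((\<beta> - \<alpha>) * a)\<^sup>2 + ((\<beta> - \<alpha>) * b)\<^sup>2 = (\<beta> - \<alpha>)\<^sup>2"
    using unit by (simp add: power_mult_distrib flip: distrib_left)
  moreover have "3 * ((\<beta> - \<alpha>) * a)\<^sup>2 \<le> ((\<beta> - \<alpha>) * b)\<^sup>2"
    using mult_left_mono[OF steep zero_le_power2[of "\<beta> - \<alpha>"]]
    by (simp add: power_mult_distrib ac_simps)
  ultimately show False
    using dichotomy_crossings[OF \<alpha>(2) \<beta>(2)] unfolding dichotomy_def by linarith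
qed

lemma same_level_not_steep:
  assumes unit: "(u' - u)\<^sup>2 + (v' - v)\<^sup>2 = 1" and eq: "level u v = level u' v'"
  shows "(v' - v)\<^sup>2 < 3 * (u' - u)\<^sup>2"
proof (rule ccontr)
  assume "\<not> ?thesis"
  then have steep: "3 * (u' - u)\<^sup>2 \<le> (v' - v)\<^sup>2" by simp
  show False
  proof (cases "v \<le> v'")
    case True
    then show False
      using same_level_not_steep_up[of "u' - u" "v' - v" "level u v" u v] unit steep
        level[of u v] level[of u' v'] eq by simp
  next
    case False
    then show False
      using same_level_not_steep_up[of "u - u'" "v - v'" "level u v" u' v'] unit steep
        level[of u v] level[of u' v'] eq by (simp add: power2_commute)
  qed
qed

lemma level_diff_le_2:
  assumes unit: "(u' - u)\<^sup>2 + (v' - v)\<^sup>2 = 1"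
  shows "level u' v' \<le> level u v + 2"
proof (rule ccontr)
  assume "\<not> ?thesis"
  then have "F (level u v + 3) u' \<le> F (level u' v') u'" by (intro F_mono) simp
  \<comment> \<open>Two whole strips lie between the points, with height at least
    \<open>2 * hgt - (1 - hgt)\<close>, which exceeds 1.\<close>
  then have "1 < v' - v"
    using level[of u v] level[of u' v'] hgt_bounds
      F_diff_ge[of "level u v + 3" "level u v + 1" u' u] by simp
  then have "1 < (v' - v)\<^sup>2" by (simp add: one_less_power)
  then show False using unit zero_le_power2[of "u' - u"] by linarith
qed

text \<open>The piece of the segment between the curves \<open>i + 1\<close> and
  \<open>i + 2\<close> has length at most 1, so condition (d) makes it steep.\<close>

lemma jump_steep:
  assumes unit: "a\<^sup>2 + b\<^sup>2 = 1"
    and p: "v < F (i + 1) u" and q: "F (i + 2) (u + a) \<le> v + b"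
  shows "hgt < b"
proof -
  have b0: "0 < b" using p q F_less2[of i u "u + a"] by linarith
  have "F (i + 1) (u + 1 * a) \<le> v + 1 * b" using q F_less2[of i "u + a" "u + a"] by simp
  then obtain \<alpha> where \<alpha>: "0 \<le> \<alpha>" "\<alpha> \<le> 1" "F (i + 1) (u + \<alpha> * a) = v + \<alpha> * b"
    using crossing[of 0 1 v b "i + 1" u a] p by auto
  have "\<alpha> \<noteq> 0" using \<alpha>(3) p by auto
  have gap: "v + \<alpha> * b < F (i + 2) (u + \<alpha> * a)"
    using \<alpha>(3) F_less2[of i "u + \<alpha> * a" "u + \<alpha> * a"] by simp
  then obtain \<beta> where \<beta>: "\<alpha> \<le> \<beta>" "\<beta> \<le> 1" "F (i + 1 + 1) (u + \<beta> * a) = v + \<beta> * b"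
    using crossing[of \<alpha> 1 v b "i + 2" u a] q \<alpha>(2) by (auto simp: add.assoc)
  have "\<alpha> \<noteq> \<beta>" using \<beta>(3) gap by (auto simp: add.assoc)
  then have pos: "0 < (\<beta> - \<alpha>)\<^sup>2" by simp
  have "(\<beta> - \<alpha>)\<^sup>2 \<le> 1" using \<alpha> \<beta> by (intro power_le_one) auto
  moreover have "((\<beta> - \<alpha>) * a)\<^sup>2 + ((\<beta> - \<alpha>) * b)\<^sup>2 = (\<beta> - \<alpha>)\<^sup>2"
    using unit by (simp add: power_mult_distrib flip: distrib_left)
  ultimately have "3 * ((\<beta> - \<alpha>) * a)\<^sup>2 \<le> ((\<beta> - \<alpha>) * b)\<^sup>2"
    using dichotomy_crossings[OF \<alpha>(3) \<beta>(3)] unfolding dichotomy_def by linarith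
  then have "(\<beta> - \<alpha>)\<^sup>2 * (3 * a\<^sup>2) \<le> (\<beta> - \<alpha>)\<^sup>2 * b\<^sup>2"
    by (simp add: power_mult_distrib ac_simps)
  then have steep: "3 * a\<^sup>2 \<le> b\<^sup>2" using pos by simp
  have "hgt\<^sup>2 \<le> b\<^sup>2" using unit steep hgt_sq by linarith
  then have "hgt \<le> b" by (rule power2_le_imp_le) (use b0 in simp)
  \<comment> \<open>In the borderline case the segment is \<open>(1/2, hgt)\<close> or
    \<open>(-1/2, hgt)\<close>. Both carry curve \<open>i + 1\<close> onto curve
    \<open>i + 2\<close>, so a start strictly below the former cannot end on or above the
    latter.\<close>
  moreover have "hgt \<noteq> b"
  proof
    assume h: "hgt = b"
    then have "a\<^sup>2 = (1/2)\<^sup>2" using unit hgt_sq by (simp add: power2_eq_square)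
    then have "a = 1/2 \<or> a = - (1/2)" by (simp add: power2_eq_iff)
    then have "F (i + 1 + 1) (u + a) = F (i + 1) u + hgt"
      by (metis F_shift diff_conv_add_uminus)
    then show False using p q h by (simp add: add.assoc)
  qed
  ultimately show ?thesis by simp
qed

end

section \<open>Heights of the sides of a unit triangle\<close>

text \<open>The two vectors have inner product 1/2. Squaring \<open>a1 * a2 = 1/2 - b1 * b2\<close>
  eliminates the horizontal coordinates.\<close>

lemma unit_triangle_heights:
  fixes a1 b1 a2 b2 :: real
  assumes "a1\<^sup>2 + b1\<^sup>2 = 1" "a2\<^sup>2 + b2\<^sup>2 = 1" "(a2 - a1)\<^sup>2 + (b2 - b1)\<^sup>2 = 1"
  shows "b1\<^sup>2 + b2\<^sup>2 = b1 * b2 + 3/4"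
proof -
  have "a1 * a2 = 1/2 - b1 * b2" using assms by (simp add: power2_eq_square algebra_simps)
  then have "(a1 * a2)\<^sup>2 = (1/2 - b1 * b2)\<^sup>2" by simp
  moreover have "a1\<^sup>2 = 1 - b1\<^sup>2" "a2\<^sup>2 = 1 - b2\<^sup>2" using assms by auto
  ultimately have "(1 - b1\<^sup>2) * (1 - b2\<^sup>2) = (1/2 - b1 * b2)\<^sup>2"
    by (simp add: power_mult_distrib)
  then show ?thesis by (simp add: power2_eq_square algebra_simps)
qed

text \<open>A unit vector is steep exactly when its squared height is at least 3/4. If
  \<open>b1 * b2 \<le> 0\<close>, the third side has squared height \<open>3/4 - b1 * b2\<close>;
  otherwise the smaller of the two squares is at most \<open>b1 * b2\<close>, so the larger is at
  least 3/4.\<close>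

lemma unit_triangle_steep_side:
  fixes a1 b1 a2 b2 :: real
  assumes "a1\<^sup>2 + b1\<^sup>2 = 1" "a2\<^sup>2 + b2\<^sup>2 = 1" "(a2 - a1)\<^sup>2 + (b2 - b1)\<^sup>2 = 1"
  shows "3 * a1\<^sup>2 \<le> b1\<^sup>2 \<or> 3 * a2\<^sup>2 \<le> b2\<^sup>2 \<or> 3 * (a2 - a1)\<^sup>2 \<le> (b2 - b1)\<^sup>2"
proof -
  have h: "b1\<^sup>2 + b2\<^sup>2 = b1 * b2 + 3/4" by (rule unit_triangle_heights[OF assms])
  have e: "(b2 - b1)\<^sup>2 = b1\<^sup>2 + b2\<^sup>2 - 2 * (b1 * b2)"
    by (simp add: power2_eq_square algebra_simps)
  have "3/4 \<le> b2\<^sup>2 \<or> 3/4 \<le> b1\<^sup>2 \<or> 3/4 \<le> (b2 - b1)\<^sup>2"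
  proof (cases "b1 * b2 \<le> 0")
    case True
    then show ?thesis using h e by linarith
  next
    case False
    then have abs: "\<bar>b1\<bar> * \<bar>b2\<bar> = b1 * b2" by (simp flip: abs_mult)
    have "b1\<^sup>2 \<le> b1 * b2 \<or> b2\<^sup>2 \<le> b1 * b2"
    proof (cases "\<bar>b1\<bar> \<le> \<bar>b2\<bar>")
      case True
      then have "\<bar>b1\<bar> * \<bar>b1\<bar> \<le> \<bar>b1\<bar> * \<bar>b2\<bar>" by (intro mult_left_mono) auto
      then show ?thesis unfolding abs by (simp add: power2_eq_square)
    next
      case False
      then have "\<bar>b2\<bar> * \<bar>b2\<bar> \<le> \<bar>b1\<bar> * \<bar>b2\<bar>" by (intro mult_right_mono) auto
      then show ?thesis unfolding abs by (simp add: power2_eq_square)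
    qed
    then show ?thesis using h by linarith
  qed
  then show ?thesis using assms by argo
qed

text \<open>Now \<open>b1 * b2\<close> exceeds 3/4, but
  \<open>(b2 - b1)\<^sup>2 = 3/4 - b1 * b2\<close>.\<close>

lemma steep_vectors_not_unit_triangle:
  fixes a1 b1 a2 b2 :: real
  assumes "a1\<^sup>2 + b1\<^sup>2 = 1" "a2\<^sup>2 + b2\<^sup>2 = 1" "(a2 - a1)\<^sup>2 + (b2 - b1)\<^sup>2 = 1"
    and "hgt < b1" "hgt < b2"
  shows False
proof -
  have "b1\<^sup>2 + b2\<^sup>2 = b1 * b2 + 3/4" by (rule unit_triangle_heights[OF assms(1-3)])
  moreover have "hgt\<^sup>2 < b1 * b2"
    using assms(4,5) hgt_bounds unfolding power2_eq_square by (intro mult_strict_mono) linarith+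
  moreover have "(b2 - b1)\<^sup>2 = b1\<^sup>2 + b2\<^sup>2 - 2 * (b1 * b2)"
    by (simp add: power2_eq_square algebra_simps)
  ultimately show False using zero_le_power2[of "b2 - b1"] hgt_sq by linarith
qed

section \<open>Levels of the vertices of a unit triangle\<close>

context profile
begin

lemma jump_level:
  assumes "(u' - u)\<^sup>2 + (v' - v)\<^sup>2 = 1" "level u' v' = level u v + 2"
  shows "hgt < v' - v"
proof (rule jump_steep[OF assms(1)])
  show "v < F (level u v + 1) u" using level by blast
  show "F (level u v + 2) (u + (u' - u)) \<le> v + (v' - v)"
    using level[of u' v'] unfolding assms(2) by simp
qed

text \<open>Adjacent levels will carry different colors, so this excludes monochromatic unit
  triangles.\<close>

lemma unit_triangle_levels:
  assumes d12: "(u2 - u1)\<^sup>2 + (v2 - v1)\<^sup>2 = 1" and d23: "(u3 - u2)\<^sup>2 + (v3 - v2)\<^sup>2 = 1"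
    and d13: "(u3 - u1)\<^sup>2 + (v3 - v1)\<^sup>2 = 1"
  shows "\<bar>level u1 v1 - level u2 v2\<bar> = 1 \<or> \<bar>level u2 v2 - level u3 v3\<bar> = 1
    \<or> \<bar>level u1 v1 - level u3 v3\<bar> = 1"
proof (rule ccontr)
  note d21 = d12[unfolded power2_commute[of u2] power2_commute[of v2]]
    and d32 = d23[unfolded power2_commute[of u3] power2_commute[of v3]]
    and d31 = d13[unfolded power2_commute[of u3] power2_commute[of v3]]
  assume neg: "\<not> ?thesis"
  \<comment> \<open>Two vertices share a level and the third is two levels away. Both sides at the
    third vertex are then strictly steep and, up to a common sign, point upwards.\<close>
  have no: False
    if unit: "(q1 - p1)\<^sup>2 + (q2 - p2)\<^sup>2 = 1" "(r1 - p1)\<^sup>2 + (r2 - p2)\<^sup>2 = 1"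
        "(r1 - q1)\<^sup>2 + (r2 - q2)\<^sup>2 = 1"
      and lev: "level q1 q2 = level r1 r2" "\<bar>level q1 q2 - level p1 p2\<bar> = 2"
    for p1 p2 q1 q2 r1 r2
  proof (cases "level q1 q2 = level p1 p2 + 2")
    case True
    then show False
      using steep_vectors_not_unit_triangle[of "q1 - p1" "q2 - p2" "r1 - p1" "r2 - p2"]
        unit lev jump_level[of q1 p1 q2 p2] jump_level[of r1 p1 r2 p2] by simp
  next
    case False
    then have "level p1 p2 = level q1 q2 + 2" using lev(2) by linarith
    then show False
      using steep_vectors_not_unit_triangle[of "p1 - q1" "p2 - q2" "p1 - r1" "p2 - r2"]
        unit lev jump_level[of p1 q1 p2 q2] jump_level[of p1 r1 p2 r2]
      by (simp add: power2_commute)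
  qed
  have "3 * (u2 - u1)\<^sup>2 \<le> (v2 - v1)\<^sup>2 \<or> 3 * (u3 - u1)\<^sup>2 \<le> (v3 - v1)\<^sup>2
      \<or> 3 * (u3 - u2)\<^sup>2 \<le> (v3 - v2)\<^sup>2"
    using unit_triangle_steep_side[OF d12 d13] d23 by simp
  then have "\<not> (level u1 v1 = level u2 v2 \<and> level u2 v2 = level u3 v3)"
    using same_level_not_steep[OF d12] same_level_not_steep[OF d23] same_level_not_steep[OF d13]
    by (metis not_less)
  \<comment> \<open>Levels differ by at most 2, so without a difference of 1 and without equality of
    all three, exactly two of them agree.\<close>
  moreover have "i = j \<and> \<bar>i - k\<bar> = 2 \<or> i = k \<and> \<bar>i - j\<bar> = 2 \<or> j = k \<and> \<bar>j - i\<bar> = 2"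
    if "\<not> (i = j \<and> j = k)" "\<bar>i - j\<bar> \<noteq> 1" "\<bar>j - k\<bar> \<noteq> 1" "\<bar>i - k\<bar> \<noteq> 1"
      "i \<le> j + 2" "j \<le> i + 2" "j \<le> k + 2" "k \<le> j + 2" "i \<le> k + 2" "k \<le> i + 2"
    for i j k :: int
    using that by presburger
  ultimately consider "level u1 v1 = level u2 v2" "\<bar>level u1 v1 - level u3 v3\<bar> = 2"
    | "level u1 v1 = level u3 v3" "\<bar>level u1 v1 - level u2 v2\<bar> = 2"
    | "level u2 v2 = level u3 v3" "\<bar>level u2 v2 - level u1 v1\<bar> = 2"
    using neg level_diff_le_2[OF d12] level_diff_le_2[OF d21] level_diff_le_2[OF d23]
      level_diff_le_2[OF d32] level_diff_le_2[OF d13] level_diff_le_2[OF d31]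
    by blast
  then show False
  proof cases
    case 1
    then show False using no[OF d31 d32 d12] by simp
  next
    case 2
    then show False using no[OF d21 d23 d13] by simp
  next
    case 3
    then show False using no[OF d12 d13 d23] by simp
  qed
qed

end

section \<open>Orthonormal coordinates, and the curve as a graph\<close>

locale frame =
  fixes x y :: plane
  assumes norm_x: "norm x = 1" and norm_y: "norm y = 1" and orthogonal_xy: "orthogonal x y"
begin

definition pt :: "real \<Rightarrow> real \<Rightarrow> plane" where
  "pt u v = u *\<^sub>R x + v *\<^sub>R y"

lemma inner_frame: "x \<bullet> x = 1" "y \<bullet> y = 1" "x \<bullet> y = 0" "y \<bullet> x = 0"
  using norm_x norm_y orthogonal_xy
  by (simp_all add: norm_eq_1 orthogonal_def inner_commute)

lemma pt_inner [simp]: "pt u v \<bullet> x = u" "pt u v \<bullet> y = v"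
  unfolding pt_def by (simp_all add: inner_add_left inner_frame)

lemma pt_coords [simp]: "pt (p \<bullet> x) (p \<bullet> y) = p"
proof -
  define w where "w = p - pt (p \<bullet> x) (p \<bullet> y)"
  have w: "w \<bullet> x = 0" "w \<bullet> y = 0" unfolding w_def by (simp_all add: inner_diff_left)
  have "w = 0"
  proof (rule ccontr)
    assume "w \<noteq> 0"
    have ne: "x \<noteq> 0" "y \<noteq> 0" using norm_x norm_y by auto
    have distinct: "x \<noteq> y" "w \<noteq> x" "w \<noteq> y"
      using inner_frame w by auto
    have "pairwise orthogonal {x, y, w}"
      using orthogonal_xy w by (auto simp: pairwise_insert orthogonal_def inner_commute)
    then have "independent {x, y, w}"
      using ne \<open>w \<noteq> 0\<close> by (intro pairwise_orthogonal_independent) auto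
    then have "card {x, y, w} \<le> DIM(plane)" by (rule independent_bound[THEN conjunct2])
    then show False using distinct by simp
  qed
  then show ?thesis unfolding w_def by simp
qed

lemma norm_sq: "(norm p)\<^sup>2 = (p \<bullet> x)\<^sup>2 + (p \<bullet> y)\<^sup>2"
proof -
  have "(norm (pt u v))\<^sup>2 = u\<^sup>2 + v\<^sup>2" for u v
    unfolding power2_norm_eq_inner pt_def
    by (simp add: inner_add_left inner_add_right inner_frame power2_eq_square)
  from this[of "p \<bullet> x" "p \<bullet> y"] show ?thesis by simp
qed

lemma dist_1_iff: "dist p q = 1 \<longleftrightarrow> (q \<bullet> x - p \<bullet> x)\<^sup>2 + (q \<bullet> y - p \<bullet> y)\<^sup>2 = 1"
proof -
  have "dist p q = 1 \<longleftrightarrow> (norm (q - p))\<^sup>2 = 1"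
    using norm_ge_zero[of "q - p"]
    by (auto simp: dist_norm norm_minus_commute power2_eq_1_iff simp del: norm_ge_zero)
  then show ?thesis by (simp add: norm_sq inner_diff_left)
qed

lemma acute_angle_less_iff:
  "acute_angle x A B < pi / 3 \<longleftrightarrow> ((B - A) \<bullet> y)\<^sup>2 < 3 * ((B - A) \<bullet> x)\<^sup>2"
proof (cases "A = B")
  case False
  define r where "r = \<bar>(B - A) \<bullet> x\<bar> / norm (B - A)"
  have pos: "0 < norm (B - A)" using False by simp
  have "\<bar>(B - A) \<bullet> x\<bar> \<le> norm (B - A)"
    using Cauchy_Schwarz_ineq2[of "B - A" x] norm_x by simp
  then have r: "0 \<le> r" "r \<le> 1" unfolding r_def using pos by (simp_all add: divide_le_eq)
  have "acute_angle x A B < pi / 3 \<longleftrightarrow> arccos r < arccos (1/2)"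
    unfolding acute_angle_def r_def norm_x
    using arccos_cos[of "pi / 3"] by (simp add: cos_60)
  also have "\<dots> \<longleftrightarrow> 1/2 < r" using r by (intro arccos_less_mono) auto
  also have "\<dots> \<longleftrightarrow> norm (B - A) < 2 * \<bar>(B - A) \<bullet> x\<bar>"
    unfolding r_def using pos by (simp add: field_simps)
  also have "\<dots> \<longleftrightarrow> (norm (B - A))\<^sup>2 < (2 * \<bar>(B - A) \<bullet> x\<bar>)\<^sup>2"
    by (rule less_iff_power2_less) auto
  also have "\<dots> \<longleftrightarrow> ((B - A) \<bullet> y)\<^sup>2 < 3 * ((B - A) \<bullet> x)\<^sup>2"
    by (simp add: norm_sq power_mult_distrib)
  finally show ?thesis .
\<comment> \<open>For \<open>A = B\<close> the quotient is 0 by the convention on division, so the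
  angle is \<open>pi / 2\<close> and both sides are false.\<close>
qed (simp add: acute_angle_def)

lemma dichotomy_iff:
  "(1 < dist A B \<longleftrightarrow> acute_angle x A B < pi / 3) \<longleftrightarrow> dichotomy ((B - A) \<bullet> x) ((B - A) \<bullet> y)"
proof -
  have "1 < dist A B \<longleftrightarrow> 1\<^sup>2 < (norm (B - A))\<^sup>2"
    using less_iff_power2_less[of 1 "norm (B - A)"] by (simp add: dist_norm norm_minus_commute)
  then show ?thesis unfolding acute_angle_less_iff dichotomy_def by (simp add: norm_sq)
qed

definition graph :: "(real \<Rightarrow> real) \<Rightarrow> plane set" where
  "graph g = {p. p \<bullet> y = g (p \<bullet> x)}"

lemma pt_in_graph [simp]: "pt u v \<in> graph g \<longleftrightarrow> v = g u"
  unfolding graph_def by simp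

lemma translate_int:
  fixes K :: "plane set"
  assumes "(\<lambda>p. p + x) ` K = K" "pt u v \<in> K"
  shows "pt (u + of_int n) v \<in> K"
proof -
  have *: "pt (u + 1) v \<in> K \<longleftrightarrow> pt u v \<in> K" for u
  proof -
    have "pt (u + 1) v = pt u v + x" unfolding pt_def by (simp add: scaleR_add_left)
    moreover have "p + x \<in> K \<longleftrightarrow> p \<in> K" for p
      using inj_image_mem_iff[of "\<lambda>p. p + x" p K] assms(1) by (simp add: inj_def)
    ultimately show ?thesis by simp
  qed
  show ?thesis using periodic_int[of "\<lambda>u. pt u v \<in> K", OF *] assms(2) by simp
qed

text \<open>The Lipschitz bound at \<open>s = 0\<close> leaves at most one point of \<open>K\<close>
  on each vertical line; continuity and periodicity give at least one.\<close>

lemma curve_is_profile_graph: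
  assumes curve: "continuous_curve K" and inv: "(\<lambda>p. p + x) ` K = K"
    and D: "\<And>A B. A \<in> K \<Longrightarrow> B \<in> K \<Longrightarrow> dichotomy ((B - A) \<bullet> x + 1/2) ((B - A) \<bullet> y + hgt)"
  obtains f where "profile f" "K = graph f"
proof -
  have D': "dichotomy (u' - u + 1/2 + of_int n) (v' - v + hgt)"
    if "pt u v \<in> K" "pt u' v' \<in> K" for u v u' v' n
    using D[OF that(1) translate_int[OF inv that(2), of n]]
    by (simp add: inner_diff_left algebra_simps)
  have unique: "v = v'" if "pt u v \<in> K" "pt u v' \<in> K" for u v v'
    using dichotomy_step(2)[of 0 "v' - v"] D'[OF that] D'[OF that(2,1)]
    by (simp add: mult_le_0_iff)
  obtain \<gamma> :: "real \<Rightarrow> plane" where \<gamma>: "continuous_on UNIV \<gamma>" "K = range \<gamma>"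
    using curve unfolding continuous_curve_def by blast
  \<comment> \<open>The projection of \<open>K\<close> to the \<open>x\<close> axis is connected and
    contains \<open>a\<close> plus every integer, hence it is everything.\<close>
  have total: "\<exists>v. pt u v \<in> K" for u
  proof -
    let ?X = "(\<lambda>p. p \<bullet> x) ` K"
    have "connected ?X"
      unfolding \<gamma>(2) image_image
      by (intro connected_continuous_image continuous_intros \<gamma>(1)) auto
    define a where "a = \<gamma> 0 \<bullet> x"
    have a: "pt a (\<gamma> 0 \<bullet> y) \<in> K" unfolding a_def \<gamma>(2) by simp
    have *: "a + of_int n \<in> ?X" for n
      using translate_int[OF inv a, of n] by (force intro: rev_image_eqI)
    have "u \<in> ?X"
      by (rule connectedD_interval[OF \<open>connected ?X\<close> *[of "\<lfloor>u - a\<rfloor>"] *[of "\<lceil>u - a\<rceil>"]])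
        linarith+
    then obtain p where "p \<in> K" "u = p \<bullet> x" by blast
    then show ?thesis by (intro exI[of _ "p \<bullet> y"]) simp
  qed
  define f where "f u = (THE v. pt u v \<in> K)" for u
  have f: "pt u v \<in> K \<longleftrightarrow> v = f u" for u v
    using theI'[of "\<lambda>v. pt u v \<in> K"] total[of u] unique[of u] unfolding f_def by blast
  have "profile f"
  proof
    show "f (u + 1) = f u" for u
      using translate_int[OF inv, of u "f u" 1] f by simp
    show "dichotomy (w - u) (f (w - 1/2) + hgt - f u)" for u w
      using D'[of u "f u" "w - 1/2" "f (w - 1/2)" 0] f by (simp add: algebra_simps)
  qed
  moreover have "K = graph f"
    using f[of "p \<bullet> x" "p \<bullet> y" for p] unfolding graph_def by auto
  ultimately show ?thesis by (rule that)
qed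

lemma graph_translate:
  "(\<lambda>p. p + pt a b) ` graph g = graph (\<lambda>u. g (u - a) + b)"
proof (rule set_eqI)
  fix p
  have "p \<in> (\<lambda>p. p + pt a b) ` graph g \<longleftrightarrow> p - pt a b \<in> graph g"
    by (force simp: image_iff algebra_simps)
  then show "p \<in> (\<lambda>p. p + pt a b) ` graph g \<longleftrightarrow> p \<in> graph (\<lambda>u. g (u - a) + b)"
    unfolding graph_def by (auto simp: inner_diff_left)
qed

end

section \<open>Strips between consecutive curves and their recoloring\<close>

locale zebra = frame x y + profile f for x y :: plane and f :: "real \<Rightarrow> real"
begin

definition strip :: "int \<Rightarrow> plane set" where
  "strip i = {p. F i (p \<bullet> x) < p \<bullet> y \<and> p \<bullet> y < F (i + 1) (p \<bullet> x)}"

abbreviation plevel :: "plane \<Rightarrow> int" where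
  "plevel p \<equiv> level (p \<bullet> x) (p \<bullet> y)"

lemma open_strip: "open (strip i)"
  unfolding strip_def
  by (intro open_Collect_conj open_Collect_less continuous_intros)

lemma strip_plevel: "p \<in> strip i \<Longrightarrow> plevel p = i"
  unfolding strip_def by (intro level_eqI) auto

lemma strip_or_graph: "p \<in> strip (plevel p) \<or> p \<in> graph (F (plevel p))"
  using level[of "p \<bullet> x" "p \<bullet> y"] unfolding strip_def graph_def by fastforce

lemma strip_nonempty: "strip i \<noteq> {}"
proof -
  have "pt 0 ((F i 0 + F (i + 1) 0) / 2) \<in> strip i"
    using F_less[of i 0 0] unfolding strip_def by simp
  then show ?thesis by blast
qed

lemma connected_strip: "connected (strip i)"
proof -
  \<comment> \<open>The strip is parametrised by the horizontal position and the relative height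
    between its two curves.\<close>
  let ?h = "\<lambda>z. pt (fst z) ((1 - snd z) * F i (fst z) + snd z * F (i + 1) (fst z))"
  have "strip i = ?h ` (UNIV \<times> {0<..<1})"
  proof (intro equalityI subsetI)
    fix p assume "p \<in> strip i"
    define u v where "u = p \<bullet> x" and "v = p \<bullet> y"
    define t where "t = (v - F i u) / (F (i + 1) u - F i u)"
    have lt: "F i u < v" "v < F (i + 1) u" using \<open>p \<in> strip i\<close> unfolding strip_def u_def v_def by auto
    then have t: "0 < t" "t < 1" unfolding t_def by auto
    have "t * (F (i + 1) u - F i u) = v - F i u" unfolding t_def using lt by auto
    then have "v = (1 - t) * F i u + t * F (i + 1) u" by (simp add: algebra_simps)
    then have "p = ?h (u, t)" unfolding u_def v_def by (metis fst_conv pt_coords snd_conv)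
    then show "p \<in> ?h ` (UNIV \<times> {0<..<1})" using t by (intro image_eqI[of _ _ "(u, t)"]) auto
  next
    fix p assume "p \<in> ?h ` (UNIV \<times> {0<..<1})"
    then obtain u t where p: "p = ?h (u, t)" and t: "0 < t" "t < 1" by auto
    define d where "d = F (i + 1) u - F i u"
    have d: "0 < d" unfolding d_def using F_less by simp
    have "(1 - t) * F i u + t * F (i + 1) u = F i u + t * d"
      "F (i + 1) u = F i u + d"
      unfolding d_def by (simp_all add: algebra_simps)
    then show "p \<in> strip i" unfolding p strip_def using t d by simp
  qed
  moreover have "connected (?h ` (UNIV \<times> {0<..<1}))"
    unfolding pt_def
    by (intro connected_continuous_image continuous_intros connected_Times) auto
  ultimately show ?thesis by simp
qed

lemma graph_in_closure_strip:
  assumes "p \<in> graph (F i)"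
  shows "p \<in> closure (strip i)" "p \<in> closure (strip (i - 1))"
proof -
  define u where "u = p \<bullet> x"
  have p: "p = pt u (F i u)"
    using assms pt_coords[of p] unfolding u_def graph_def by simp
  have near: "dist (pt u (F i u + \<epsilon>)) p = \<bar>\<epsilon>\<bar>" for \<epsilon>
    unfolding p pt_def dist_norm using norm_y by (simp add: scaleR_add_left)
  define g where "g = min (F (i + 1) u - F i u) (F i u - F (i - 1) u)"
  have g: "0 < g" unfolding g_def using F_less[of i u u] F_less[of "i - 1" u u] by simp
  have "pt u (F i u + \<epsilon>) \<in> strip i" "pt u (F i u - \<epsilon>) \<in> strip (i - 1)"
    if "0 < \<epsilon>" "\<epsilon> < g" for \<epsilon>
    using that unfolding strip_def g_def by auto
  moreover have "\<exists>\<epsilon>. 0 < \<epsilon> \<and> \<epsilon> < g \<and> \<epsilon> < e" if "0 < e" for e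
    using field_lbound_gt_zero[OF g that] .
  moreover have "dist (pt u (F i u - \<epsilon>)) p = \<bar>\<epsilon>\<bar>" for \<epsilon>
    using near[of "- \<epsilon>"] by simp
  ultimately show "p \<in> closure (strip i)" "p \<in> closure (strip (i - 1))"
    unfolding closure_approachable using near by (metis abs_of_pos)+
qed

lemma frontier_strip: "frontier (strip i) = graph (F i) \<union> graph (F (i + 1))"
proof -
  let ?C = "{p. F i (p \<bullet> x) \<le> p \<bullet> y \<and> p \<bullet> y \<le> F (i + 1) (p \<bullet> x)}"
  have "closed ?C" by (intro closed_Collect_conj closed_Collect_le continuous_intros)
  then have "closure (strip i) \<subseteq> ?C"
    by (rule closure_minimal[rotated]) (auto simp: strip_def)
  moreover have "?C - strip i \<subseteq> graph (F i) \<union> graph (F (i + 1))"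
    unfolding strip_def graph_def by auto
  moreover have "graph (F i) \<union> graph (F (i + 1)) \<subseteq> closure (strip i)"
    using graph_in_closure_strip(1)[of _ i] graph_in_closure_strip(2)[of _ "i + 1"] by auto
  moreover have "(graph (F i) \<union> graph (F (i + 1))) \<inter> strip i = {}"
    unfolding strip_def graph_def by auto
  ultimately show ?thesis
    unfolding frontier_def interior_open[OF open_strip] by blast
qed

text \<open>A connected set properly containing the strip would meet its frontier, which is the
  union of the two curves; so the strip is a component with the required frontier. This passes the
  colors of the delimited regions to the strips.\<close>

lemma strip_subset_delimited_region:
  "strip i \<subseteq> interior (delimited_region (graph (F i) \<union> graph (F (i + 1))))"
proof -
  let ?C = "graph (F i) \<union> graph (F (i + 1))"
  have "strip i \<in> components (- ?C)"
    unfolding in_components_maximal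
  proof (intro conjI allI impI)
    show "strip i \<subseteq> - ?C" unfolding strip_def graph_def by auto
    fix T assume T: "T \<noteq> {} \<and> strip i \<subseteq> T \<and> T \<subseteq> - ?C \<and> connected T"
    show "T = strip i"
    proof (rule ccontr)
      assume "T \<noteq> strip i"
      then have "T \<inter> frontier (strip i) \<noteq> {}"
        using T strip_nonempty[of i] by (intro connected_Int_frontier) auto
      then show False using T unfolding frontier_strip by blast
    qed
  qed (rule strip_nonempty connected_strip)+
  then have "strip i \<subseteq> delimited_region ?C"
    unfolding delimited_region_def using frontier_strip by blast
  then show ?thesis by (rule interior_maximal) (rule open_strip)
qed

text \<open>The half-open strips make every curve take the colour of the strip above it.\<close>

definition recolored :: "coloring \<Rightarrow> coloring" where
  "recolored c = ({p. strip (plevel p) \<subseteq> black c}, {p. strip (plevel p) \<subseteq> white c})"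

context
  fixes c :: coloring
  assumes col: "is_coloring c"
    and diff: "\<And>i. differently_colored c (strip i) (strip (i - 1))"
    and bd: "boundary c = (\<Union>i. graph (F i))"
begin

lemma strip_black_iff: "strip i \<subseteq> black c \<longleftrightarrow> \<not> strip i \<subseteq> white c"
  using diff[of i] strip_nonempty[of i] col
  unfolding differently_colored_def is_coloring_def by blast

lemma strip_alternate: "\<bar>i - j\<bar> = 1 \<Longrightarrow> strip i \<subseteq> black c \<longleftrightarrow> strip j \<subseteq> white c"
proof -
  assume "\<bar>i - j\<bar> = 1"
  then consider "j = i - 1" | "i = j - 1" by linarith
  then show ?thesis
    using diff[of i] diff[of j] strip_black_iff unfolding differently_colored_def by cases metis+
qed

lemma is_coloring_recolored: "is_coloring (recolored c)"
  unfolding is_coloring_def recolored_def using strip_black_iff by auto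

lemma recolored_strip:
  assumes "p \<in> strip i"
  shows "p \<in> black (recolored c) \<longleftrightarrow> strip i \<subseteq> black c"
    "p \<in> white (recolored c) \<longleftrightarrow> strip i \<subseteq> white c"
  using strip_plevel[OF assms] unfolding recolored_def by simp_all

text \<open>For complementary color classes the boundary is the intersection of their closures. Each
  curve lies in the closures of the two strips beside it, which differ in color, while an open strip
  misses one color altogether.\<close>

lemma boundary_recolored: "boundary (recolored c) = (\<Union>i. graph (F i))"
proof -
  let ?B = "black (recolored c)" and ?W = "white (recolored c)"
  have W: "?W = - ?B" using is_coloring_recolored unfolding is_coloring_def by blast
  have bd': "boundary (recolored c) = closure ?B \<inter> closure ?W"
    unfolding boundary_def frontier_closures W by auto
  show ?thesis
  proof (intro equalityI subsetI)
    fix p assume "p \<in> (\<Union>i. graph (F i))"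
    then obtain i where p: "p \<in> graph (F i)" by blast
    have "(strip i \<subseteq> ?B \<and> strip (i - 1) \<subseteq> ?W) \<or> (strip i \<subseteq> ?W \<and> strip (i - 1) \<subseteq> ?B)"
      using diff[of i] recolored_strip unfolding differently_colored_def by blast
    then show "p \<in> boundary (recolored c)"
      unfolding bd' using graph_in_closure_strip[OF p] closure_mono by blast
  next
    fix p assume p: "p \<in> boundary (recolored c)"
    show "p \<in> (\<Union>i. graph (F i))"
    proof (rule ccontr)
      assume "p \<notin> (\<Union>i. graph (F i))"
      then have p': "p \<in> strip (plevel p)" using strip_or_graph[of p] by blast
      have "strip (plevel p) \<inter> ?W = {} \<or> strip (plevel p) \<inter> ?B = {}"
        using strip_black_iff[of "plevel p"] recolored_strip[of _ "plevel p"] by blast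
      then have "strip (plevel p) \<inter> closure ?W = {} \<or> strip (plevel p) \<inter> closure ?B = {}"
        using open_Int_closure_eq_empty[OF open_strip] by blast
      then show False using p p' unfolding bd' by blast
    qed
  qed
qed

lemma twin_recolored: "twin (recolored c) c"
  unfolding twin_def bd boundary_recolored
proof (intro conjI allI impI is_coloring_recolored refl)
  fix p assume "p \<notin> (\<Union>i. graph (F i))"
  then have p: "p \<in> strip (plevel p)" using strip_or_graph[of p] by blast
  then show "p \<in> black (recolored c) \<longleftrightarrow> p \<in> black c" "p \<in> white (recolored c) \<longleftrightarrow> p \<in> white c"
    using recolored_strip[OF p] strip_black_iff[of "plevel p"] col
    unfolding is_coloring_def by blast+
qed

lemma recolored_avoids_unit_triangle: "avoids_unit_triangle (recolored c)"
  unfolding avoids_unit_triangle_def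
proof
  assume "\<exists>T. unit_triangle T \<and> (T \<subseteq> black (recolored c) \<or> T \<subseteq> white (recolored c))"
  then obtain p q r where d: "dist p q = 1" "dist q r = 1" "dist p r = 1"
    and mono: "{p, q, r} \<subseteq> black (recolored c) \<or> {p, q, r} \<subseteq> white (recolored c)"
    unfolding unit_triangle_def by blast
  have "\<bar>plevel p - plevel q\<bar> = 1 \<or> \<bar>plevel q - plevel r\<bar> = 1 \<or> \<bar>plevel p - plevel r\<bar> = 1"
    using unit_triangle_levels d unfolding dist_1_iff by blast
  moreover have "\<not> (strip i \<subseteq> black c \<and> strip j \<subseteq> black c)"
    "\<not> (strip i \<subseteq> white c \<and> strip j \<subseteq> white c)" if "\<bar>i - j\<bar> = 1" for i j
    using strip_alternate[OF that] strip_black_iff[of i] strip_black_iff[of j] by blast+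
  moreover have "(strip (plevel p) \<subseteq> black c \<and> strip (plevel q) \<subseteq> black c \<and> strip (plevel r) \<subseteq> black c)
      \<or> (strip (plevel p) \<subseteq> white c \<and> strip (plevel q) \<subseteq> white c \<and> strip (plevel r) \<subseteq> white c)"
    using mono unfolding recolored_def by simp
  ultimately show False by meson
qed

end

end

section \<open>From the curves of a zebra-like coloring to strips\<close>

theorem theorem3:
  fixes c :: coloring
  assumes "is_coloring c" and "zebra_like c"
  shows "\<exists>c'. twin c' c \<and> avoids_unit_triangle c'"
proof -
  from assms(2) obtain L :: "int \<Rightarrow> plane set" and x y where
    bd: "boundary c = (\<Union>i. L i)" and curve: "\<forall>i. continuous_curve (L i)"
    and frame: "norm x = 1" "norm y = 1" "orthogonal x y"
    and inv: "\<forall>i. (\<lambda>p. p + x) ` L i = L i"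
    and shift: "\<forall>i. L (i + 1) = (\<lambda>p. p + (1 / 2) *\<^sub>R x + (sqrt 3 / 2) *\<^sub>R y) ` L i"
    and diff: "\<forall>i. differently_colored c
        (interior (delimited_region (L i \<union> L (i + 1))))
        (interior (delimited_region (L (i - 1) \<union> L i)))"
    and angle: "\<forall>i. \<forall>A\<in>L i. \<forall>B\<in>L (i + 1). dist A B > 1 \<longleftrightarrow> acute_angle x A B < pi / 3"
    unfolding zebra_like_def by (elim exE conjE) (rule that)
  interpret frame x y using frame by unfold_locales
  have shift': "L (i + 1) = (\<lambda>p. p + pt (1/2) hgt) ` L i" for i
    unfolding shift[rule_format] pt_def by (simp add: add.assoc)
  obtain f where "profile f" and f: "L 0 = graph f"
  proof (rule curve_is_profile_graph[OF curve[rule_format] inv[rule_format]])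
    fix A B assume "A \<in> L 0" "B \<in> L 0"
    \<comment> \<open>Condition (d) is applied to \<open>A\<close> and the translate of
      \<open>B\<close>, which lies in \<open>L 1\<close>.\<close>
    then have "dichotomy ((B + pt (1/2) hgt - A) \<bullet> x) ((B + pt (1/2) hgt - A) \<bullet> y)"
      using angle[rule_format, of A 0 "B + pt (1/2) hgt"] shift'[of 0] dichotomy_iff by auto
    then show "dichotomy ((B - A) \<bullet> x + 1/2) ((B - A) \<bullet> y + hgt)"
      by (simp add: inner_diff_left inner_add_left algebra_simps)
  qed
  interpret profile f by fact
  interpret zebra x y f by unfold_locales
  have F_Suc: "F (i + 1) = (\<lambda>u. F i (u - 1/2) + hgt)" for i
    using F_shift(1)[of i "u - 1/2" for u] by auto
  have L: "L i = graph (F i)" for i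
  proof (induction i rule: int_induct[where k = 0])
    case base
    then show ?case using f unfolding F_def by simp
  next
    case (step1 i)
    then show ?case unfolding shift' F_Suc graph_translate[symmetric] by simp
  next
    case (step2 i)
    \<comment> \<open>For the downward step the translates of both sets are compared; translation is
      injective.\<close>
    have "(\<lambda>p. p + pt (1/2) hgt) ` L (i - 1) = (\<lambda>p. p + pt (1/2) hgt) ` graph (F (i - 1))"
      using step2(2) shift'[of "i - 1"] F_Suc[of "i - 1"] graph_translate by simp
    then show ?case by (simp add: inj_image_eq_iff inj_def)
  qed
  have "differently_colored c (strip i) (strip (i - 1))" for i
    using diff[rule_format, of i] strip_subset_delimited_region[of i] strip_subset_delimited_region[of "i - 1"]
    unfolding L differently_colored_def by auto
  moreover have "boundary c = (\<Union>i. graph (F i))" unfolding bd L ..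
  ultimately show ?thesis
    using twin_recolored recolored_avoids_unit_triangle assms(1) by blast
qed

end
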